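(* Let $n\ge 1$, let $\upsilon\in\mathcal{M}(\mathbf{n})$ be a multiset (urn) and let $L=\|\upsilon\|$ be its size. Then for each $K\in\mathbb{N}$ with $K\le L$ one has the equality of (signed) distributions on $\mathcal{M}[K](\mathbf{n})$ $$\mathrm{shg}[K](\upsilon)=\mathrm{hg}[K](\upsilon),$$ i.e. the signed hypergeometric distribution coincides with the ordinary hypergeometric distribution when there are no overdraws.
   Context: For $n\ge1$ let $\mathbf{n}=\{0,\dots,n-1\}$. A multiset on $\mathbf{n}$ is a function $\varphi:\mathbf{n}\to\mathbb{N}$; $\mathcal{M}(\mathbf{n})$ is the set of all multisets, $\|\varphi\|=\sum_i\varphi(i)$ is the size, and $\mathcal{M}[K](\mathbf{n})$ is the set of multisets of size $K$. Write $\varphi!=\prod_i\varphi(i)!$, write $\varphi\le\upsilon$ for the pointwise order, and for $\varphi\le\upsilon$ put $\binom{\upsilon}{\varphi}=\prod_i\binom{\upsilon(i)}{\varphi(i)}$. A signed distribution on a finite set $X$ is a function $\sigma:X\to\mathbb{R}$ with $\sum_x\sigma(x)=1$. Simplex: $\Delta^n=\{\vec r\in\mathbb{R}_{\ge0}^n\mid\sum_i r_i=1\}$. Integrals over $\Delta^n$ are with respect to Lebesgue measure in the coordinates $(r_0,\dots,r_{n-2})$ (a point mass $1$ if $n=1$), so that $\int_{\Delta^n}\prod_i r_i^{\varphi(i)}\,d\vec r=\frac{\varphi!}{(\|\varphi\|+n-1)!}$ for every multiset $\varphi$. For $\varphi\in\mathcal{M}[K](\mathbf{n})$ let $\mathfrak{m}_\varphi:\Delta^n\to\mathbb{R}$,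 $\mathfrak{m}_\varphi(\vec r)=\frac{K!}{\varphi!}\prod_i r_i^{\varphi(i)}$. Let $P_K(\Delta^n)$ be the real vector space of functions on $\Delta^n$ spanned by the $\mathfrak{m}_\varphi$, $\varphi\in\mathcal{M}[K](\mathbf{n})$ (these form a basis), with inner product $\langle f,g\rangle=\int_{\Delta^n}f(\vec r)g(\vec r)\,d\vec r$. The dual multinomials $(\mathfrak{d}_\psi)_{\psi\in\mathcal{M}[K](\mathbf{n})}$ are the unique elements of $P_K(\Delta^n)$ with $\langle\mathfrak{m}_\varphi,\mathfrak{d}_\psi\rangle=\delta_{\varphi,\psi}$ for all $\varphi,\psi\in\mathcal{M}[K](\mathbf{n})$. Thus for any multiset $\upsilon$, $\mathfrak{d}_\upsilon\in P_{\|\upsilon\|}(\Delta^n)$. Signed hypergeometric: for any $\upsilon\in\mathcal{M}(\mathbf{n})$ and any $K\in\mathbb{N}$, $\mathrm{shg}[K](\upsilon)$ is the signed distribution on $\mathcal{M}[K](\mathbf{n})$ given by $\mathrm{shg}[K](\upsilon)(\varphi)=\int_{\Delta^n}\mathfrak{m}_\varphi(\vec r)\,\mathfrak{d}_\upsilon(\vec r)\,d\vec r$. Ordinary hypergeometric: for $K\le L=\|\upsilon\|$, $\mathrm{hg}[K](\upsilon)(\varphi)=\binom{\upsilon}{\varphi}/\binom{L}{K}$ if $\varphi\in\mathcal{M}[K](\mathbf{n})$ satisfies $\varphi\le\upsilon$, and $0$ for the other $\varphi\in\mathcal{M}[K](\mathbf{n})$. *)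

theory Defs
  imports "HOL-Analysis.Analysis" "HOL-Library.Multiset"
begin

text \<open>
  Multisets on $\{0,\dots,n-1\}$ are values \<open>\<phi> :: nat multiset\<close> with \<open>set_mset \<phi> \<subseteq> {..<n}\<close>; those of
  size \<open>K\<close> form the library set \<open>multisets_of_size {..<n} K\<close>. The pointwise order is \<open>\<subseteq>#\<close>.
  Vectors in $\mathbb{R}^n$ are elements of \<open>{..<n} \<rightarrow>\<^sub>E UNIV\<close>, and a function on a set \<open>X\<close> is
  represented by its restriction to \<open>X\<close>, so that \<open>=\<close> is equality of functions on \<open>X\<close>.
\<close>

definition mset_fact :: "nat \<Rightarrow> nat multiset \<Rightarrow> nat" where
  "mset_fact n \<phi> = (\<Prod>i<n. fact (count \<phi> i))"

definition mset_binom :: "nat \<Rightarrow> nat multiset \<Rightarrow> nat multiset \<Rightarrow> nat" where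
  "mset_binom n \<upsilon> \<phi> = (\<Prod>i<n. count \<upsilon> i choose count \<phi> i)"

definition prob_simplex :: "nat \<Rightarrow> (nat \<Rightarrow> real) set" where
  "prob_simplex n = {r \<in> {..<n} \<rightarrow>\<^sub>E UNIV. (\<forall>i<n. 0 \<le> r i) \<and> (\<Sum>i<n. r i) = 1}"

text \<open>
  The measure on the simplex is Lebesgue measure in the first \<open>n - 1\<close> coordinates: it is pushed
  forward along the parametrisation of the hyperplane $\sum_i r_i = 1$ by these coordinates and
  then restricted to the simplex. For \<open>n = 1\<close> the empty product \<open>PiM {} _\<close> is a point mass 1.
\<close>

definition add_last_coord :: "nat \<Rightarrow> (nat \<Rightarrow> real) \<Rightarrow> (nat \<Rightarrow> real)" where
  "add_last_coord n x = x(n - 1 := 1 - (\<Sum>i<n - 1. x i))"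

definition simplex_measure :: "nat \<Rightarrow> (nat \<Rightarrow> real) measure" where
  "simplex_measure n =
     restrict_space
       (distr (Pi\<^sub>M {..<n - 1} (\<lambda>_. lborel)) (Pi\<^sub>M {..<n} (\<lambda>_. lborel)) (add_last_coord n))
       (prob_simplex n)"

definition simplex_inner ::
    "nat \<Rightarrow> ((nat \<Rightarrow> real) \<Rightarrow> real) \<Rightarrow> ((nat \<Rightarrow> real) \<Rightarrow> real) \<Rightarrow> real" where
  "simplex_inner n f g = (LINT r|simplex_measure n. f r * g r)"

definition multinom :: "nat \<Rightarrow> nat multiset \<Rightarrow> (nat \<Rightarrow> real) \<Rightarrow> real" where
  "multinom n \<phi> =
     (\<lambda>r\<in>prob_simplex n. fact (size \<phi>) / real (mset_fact n \<phi>) * (\<Prod>i<n. r i ^ count \<phi> i))"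

text \<open>The linear span of the multinomials of size \<open>K\<close>, as functions on the simplex.\<close>

definition multinom_space :: "nat \<Rightarrow> nat \<Rightarrow> ((nat \<Rightarrow> real) \<Rightarrow> real) set" where
  "multinom_space n K =
     {(\<lambda>r\<in>prob_simplex n. \<Sum>\<phi>\<in>multisets_of_size {..<n} K. c \<phi> * multinom n \<phi> r) |
        c :: nat multiset \<Rightarrow> real. True}"

definition dual_multinom :: "nat \<Rightarrow> nat multiset \<Rightarrow> (nat \<Rightarrow> real) \<Rightarrow> real" where
  "dual_multinom n \<psi> =
     (THE d. d \<in> multinom_space n (size \<psi>) \<and>
        (\<forall>\<phi>\<in>multisets_of_size {..<n} (size \<psi>).
           simplex_inner n (multinom n \<phi>) d = (if \<phi> = \<psi> then 1 else 0)))"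

definition shg :: "nat \<Rightarrow> nat \<Rightarrow> nat multiset \<Rightarrow> nat multiset \<Rightarrow> real" where
  "shg n K \<upsilon> =
     (\<lambda>\<phi>\<in>multisets_of_size {..<n} K.
        LINT r|simplex_measure n. multinom n \<phi> r * dual_multinom n \<upsilon> r)"

definition hg :: "nat \<Rightarrow> nat \<Rightarrow> nat multiset \<Rightarrow> nat multiset \<Rightarrow> real" where
  "hg n K \<upsilon> =
     (\<lambda>\<phi>\<in>multisets_of_size {..<n} K.
        if \<phi> \<subseteq># \<upsilon> then real (mset_binom n \<upsilon> \<phi>) / real (size \<upsilon> choose K) else 0)"

end

theory Submission
  imports Defs
begin

text \<open>
  On the simplex a multinomial of size \<open>K \<le> L\<close> is a linear combination of multinomials of size
  \<open>L\<close>, and the coefficients are hypergeometric probabilities. Integrating against the dual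
  multinomial of \<open>\<upsilon>\<close> therefore picks out the coefficient at \<open>\<upsilon>\<close>. As the dual multinomials are
  given by a definite description, one also needs that the Gram matrix of the multinomials is
  positive definite: a linear combination with vanishing square integral vanishes on the interior
  of the simplex, hence has zero coefficients. No value of an integral over the simplex is computed.
\<close>

section \<open>Multinomial expansions on the simplex\<close>

text \<open>With factorials as denominators, adjoining one element to \<open>A\<close> is the Cauchy
  product for the exponential series of a sum: one factor carries the multiplicity of the new
  element, the other is the induction hypothesis.\<close>

lemma multinomial_theorem_fact:
  fixes r :: "'a \<Rightarrow> real"
  assumes "finite A"
  shows "(\<Sum>i\<in>A. r i) ^ m / fact m =
    (\<Sum>\<omega>\<in>multisets_of_size A m. (\<Prod>i\<in>A. r i ^ count \<omega> i / fact (count \<omega> i)))"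
  using assms
proof (induction A arbitrary: m rule: finite_induct)
  case empty
  then show ?case by (cases "m = 0") auto
next
  case (insert a A)
  let ?q = "\<lambda>B \<omega>. \<Prod>i\<in>B. r i ^ count \<omega> i / fact (count \<omega> i)"
  have q_add: "?q (insert a A) (\<omega> + replicate_mset j a) = r a ^ j / fact j * ?q A \<omega>"
    if "\<omega> \<in> multisets_of_size A l" for \<omega> j l
  proof -
    have "a \<notin># \<omega>"
      using that insert.hyps by (auto simp: multisets_of_size_def)
    then have "?q A (\<omega> + replicate_mset j a) = ?q A \<omega>" "count \<omega> a = 0"
      using insert.hyps by (auto intro!: prod.cong simp: not_in_iff)
    then show ?thesis
      using insert.hyps by simp
  qed
  \<comment> \<open>A multiset on \<open>insert a A\<close> is split into the multiplicity
    \<open>j\<close> of \<open>a\<close> and a remainder on \<open>A\<close> of size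
    \<open>m - j\<close>.\<close>
  have "(\<Sum>\<omega>\<in>multisets_of_size (insert a A) m. ?q (insert a A) \<omega>) =
      (\<Sum>(j,\<omega>)\<in>(SIGMA j:{0..m}. multisets_of_size A (m - j)).
        ?q (insert a A) (\<omega> + replicate_mset j a))"
    by (subst sum.reindex_bij_betw[OF bij_betw_multisets_of_size_insert[OF insert.hyps(2)], symmetric])
      (simp add: case_prod_unfold)
  also have "\<dots> = (\<Sum>j=0..m. \<Sum>\<omega>\<in>multisets_of_size A (m - j).
      ?q (insert a A) (\<omega> + replicate_mset j a))"
    by (subst sum.Sigma) (use insert.hyps in auto)
  also have "\<dots> = (\<Sum>j=0..m. r a ^ j / fact j * (\<Sum>\<omega>\<in>multisets_of_size A (m - j). ?q A \<omega>))"
    by (simp only: sum_distrib_left q_add cong: sum.cong)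
  also have "\<dots> = (\<Sum>j\<le>m. r a ^ j / fact j * ((\<Sum>i\<in>A. r i) ^ (m - j) / fact (m - j)))"
    by (simp add: insert.IH atMost_atLeast0)
  also have "\<dots> = (r a + (\<Sum>i\<in>A. r i)) ^ m / fact m"
    using exp_series_add_commuting[of "r a" "\<Sum>i\<in>A. r i" m]
    by (simp add: divide_inverse mult.commute)
  finally show ?case
    using insert.hyps by simp
qed

lemma multinom_simplex:
  assumes "r \<in> prob_simplex n"
  shows "multinom n \<phi> r =
    fact (size \<phi>) * (\<Prod>i<n. r i ^ count \<phi> i / fact (count \<phi> i))"
  using assms by (simp add: multinom_def mset_fact_def prod_dividef)

text \<open>Divided powers multiply up to a binomial coefficient; taken over all coordinates, these
  coefficients form \<open>mset_binom\<close>.\<close>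

lemma power_div_fact_mult:
  fixes x :: real
  shows "x ^ c / fact c * (x ^ d / fact d) = real (c + d choose c) * (x ^ (c + d) / fact (c + d))"
  by (simp add: binomial_fact power_add)

text \<open>Multiply \<open>multinom n \<phi> r\<close> by $(\sum_i r_i)^{L-K} = 1$ and expand the power.\<close>
lemma multinom_eq_sum_hg:
  assumes r: "r \<in> prob_simplex n" and \<phi>: "\<phi> \<in> multisets_of_size {..<n} K" and "K \<le> L"
  shows "multinom n \<phi> r = (\<Sum>\<omega>\<in>multisets_of_size {..<n} L. hg n K \<omega> \<phi> * multinom n \<omega> r)"
proof -
  define q where "q \<omega> = (\<Prod>i<n. r i ^ count \<omega> i / fact (count \<omega> i))" for \<omega>
  define m where "m = L - K"
  have L: "L = K + m"
    using \<open>K \<le> L\<close> by (simp add: m_def)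
  have size_\<phi>: "size \<phi> = K"
    using \<phi> by (simp add: multisets_of_size_def)
  \<comment> \<open>Subtracting \<open>\<phi>\<close> is inverse to adding it because it loses
    nothing on multisets that contain \<open>\<phi>\<close>.\<close>
  have bij: "bij_betw ((+) \<phi>) (multisets_of_size {..<n} m)
      {\<omega> \<in> multisets_of_size {..<n} L. \<phi> \<subseteq># \<omega>}"
    by (rule bij_betw_byWitness[where f' = "\<lambda>\<omega>. \<omega> - \<phi>"])
      (use \<phi> L in \<open>auto simp: multisets_of_size_def size_Diff_submset dest: in_diffD\<close>)
  \<comment> \<open>The coordinates sum to 1 on the simplex, so the power in the multinomial theorem
    disappears.\<close>
  have "1 / fact m = (\<Sum>\<omega>\<in>multisets_of_size {..<n} m. q \<omega>)"
    using multinomial_theorem_fact[of "{..<n}" r m] r by (simp add: prob_simplex_def q_def)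
  then have "q \<phi> / fact m = (\<Sum>\<omega>\<in>multisets_of_size {..<n} m. q \<phi> * q \<omega>)"
    by (metis sum_distrib_left mult.right_neutral times_divide_eq_right)
  also have "\<dots> = (\<Sum>\<omega>\<in>multisets_of_size {..<n} m. real (mset_binom n (\<phi> + \<omega>) \<phi>) * q (\<phi> + \<omega>))"
    by (simp only: q_def mset_binom_def power_div_fact_mult of_nat_prod count_union flip: prod.distrib)
  also have "\<dots> = (\<Sum>\<omega> | \<omega> \<in> multisets_of_size {..<n} L \<and> \<phi> \<subseteq># \<omega>. real (mset_binom n \<omega> \<phi>) * q \<omega>)"
    by (rule sum.reindex_bij_betw[OF bij])
  finally have sum_q: "(\<Sum>\<omega> | \<omega> \<in> multisets_of_size {..<n} L \<and> \<phi> \<subseteq># \<omega>.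
      real (mset_binom n \<omega> \<phi>) * q \<omega>) = q \<phi> / fact m" ..
  \<comment> \<open>The factor \<open>fact L\<close> of the multinomial cancels against the
    denominator \<open>L choose K\<close>, which leaves \<open>fact K * fact m\<close> independently
    of \<open>\<omega>\<close>.\<close>
  have "hg n K \<omega> \<phi> * multinom n \<omega> r =
      (if \<phi> \<subseteq># \<omega> then fact K * fact m * (real (mset_binom n \<omega> \<phi>) * q \<omega>) else 0)"
    if "\<omega> \<in> multisets_of_size {..<n} L" for \<omega>
    using that \<phi> r L
    by (simp add: hg_def multinom_simplex q_def binomial_fact multisets_of_size_def)
  then have "(\<Sum>\<omega>\<in>multisets_of_size {..<n} L. hg n K \<omega> \<phi> * multinom n \<omega> r) =
      (\<Sum>\<omega>\<in>multisets_of_size {..<n} L.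
        if \<phi> \<subseteq># \<omega> then fact K * fact m * (real (mset_binom n \<omega> \<phi>) * q \<omega>) else 0)"
    by (intro sum.cong) auto
  also have "\<dots> = fact K * fact m * (q \<phi> / fact m)"
    by (simp add: sum.inter_filter[symmetric] finite_multisets_of_size sum_q sum_distrib_left[symmetric])
  also have "\<dots> = multinom n \<phi> r"
    using r size_\<phi> by (simp add: multinom_simplex q_def)
  finally show ?thesis ..
qed

section \<open>Linear systems with a definite matrix\<close>

text \<open>Induction on \<open>I\<close>: subtracting from the new basis vector its projection onto the
  old ones leaves a vector orthogonal to them, whose norm is nonzero.\<close>
lemma definite_linear_system_solvable:
  fixes G :: "'a \<Rightarrow> 'a \<Rightarrow> real"
  assumes "finite I"
    and "\<And>c. (\<Sum>i\<in>I. \<Sum>j\<in>I. c i * c j * G i j) = 0 \<Longrightarrow> \<forall>i\<in>I. c i = 0"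
  shows "\<exists>x. \<forall>i\<in>I. (\<Sum>j\<in>I. G i j * x j) = b i"
  using assms
proof (induction I arbitrary: b rule: finite_induct)
  case empty
  then show ?case by simp
next
  case (insert k I)
  have G_upd: "(\<Sum>j\<in>insert k I. G i j * (f(k := z)) j) = G i k * z + (\<Sum>j\<in>I. G i j * f j)" for i f z
  proof -
    have "(\<Sum>j\<in>I. G i j * (f(k := z)) j) = (\<Sum>j\<in>I. G i j * f j)"
      using insert.hyps by (intro sum.cong) auto
    then show ?thesis
      using insert.hyps by simp
  qed
  have definite: "\<forall>i\<in>I. c i = 0" if "(\<Sum>i\<in>I. \<Sum>j\<in>I. c i * c j * G i j) = 0" for c
  proof -
    \<comment> \<open>Extension by zero turns a vector on \<open>I\<close> into one on
      \<open>insert k I\<close> with the same value of the quadratic form.\<close>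
    let ?c = "c(k := 0)"
    have "(\<Sum>i\<in>insert k I. \<Sum>j\<in>insert k I. ?c i * ?c j * G i j) = (\<Sum>i\<in>I. \<Sum>j\<in>I. ?c i * ?c j * G i j)"
      using insert.hyps by simp
    also have "\<dots> = (\<Sum>i\<in>I. \<Sum>j\<in>I. c i * c j * G i j)"
      using insert.hyps by (intro sum.cong) auto
    finally have "\<forall>i\<in>insert k I. ?c i = 0"
      using insert.prems[of ?c] that by simp
    then show ?thesis
      using insert.hyps by (metis fun_upd_other insertI2)
  qed
  note IH = insert.IH[OF definite]
  \<comment> \<open>These coefficients are chosen so that \<open>e\<close>, which adds the entry 1
    at \<open>k\<close>, is annihilated by every row in \<open>I\<close>.\<close>
  obtain p where p: "\<And>i. i \<in> I \<Longrightarrow> (\<Sum>j\<in>I. G i j * p j) = - G i k"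
    using IH[of "\<lambda>i. - G i k"] by blast
  obtain y where y: "\<And>i. i \<in> I \<Longrightarrow> (\<Sum>j\<in>I. G i j * y j) = b i"
    using IH[of b] by blast
  define e where "e = p(k := 1)"
  define N where "N = (\<Sum>j\<in>insert k I. G k j * e j)"
  have e_orth: "(\<Sum>j\<in>insert k I. G i j * e j) = 0" if "i \<in> I" for i
    using that p by (simp add: e_def G_upd del: fun_upd_apply)
  \<comment> \<open>If \<open>N\<close> were 0, all rows would annihilate \<open>e\<close> and the
    quadratic form would vanish there, although \<open>e k = 1\<close>.\<close>
  have "N \<noteq> 0"
  proof
    assume "N = 0"
    then have "(\<Sum>j\<in>insert k I. G i j * e j) = 0" if "i \<in> insert k I" for i
      using that e_orth by (auto simp: N_def)
    then have "(\<Sum>i\<in>insert k I. e i * (\<Sum>j\<in>insert k I. G i j * e j)) = 0"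
      by (intro sum.neutral ballI) simp
    then have "(\<Sum>i\<in>insert k I. \<Sum>j\<in>insert k I. e i * e j * G i j) = 0"
      by (simp only: sum_distrib_left mult_ac)
    then show False
      using insert.prems[of e] by (simp add: e_def)
  qed
  \<comment> \<open>Adding a multiple of \<open>e\<close> to \<open>y(k := 0)\<close> leaves the
    rows in \<open>I\<close> solved; \<open>t\<close> is the multiple that corrects row
    \<open>k\<close>.\<close>
  define t where "t = (b k - (\<Sum>j\<in>I. G k j * y j)) / N"
  let ?x = "\<lambda>j. (y(k := 0)) j + t * e j"
  have x: "(\<Sum>j\<in>insert k I. G i j * ?x j) =
      (\<Sum>j\<in>I. G i j * y j) + t * (\<Sum>j\<in>insert k I. G i j * e j)" for i
  proof -
    have "(\<Sum>j\<in>insert k I. G i j * ?x j) = (\<Sum>j\<in>insert k I. G i j * (y(k := 0)) j) +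
        t * (\<Sum>j\<in>insert k I. G i j * e j)"
      by (simp only: distrib_left sum.distrib sum_distrib_left mult_ac)
    then show ?thesis
      by (simp only: G_upd mult_zero_right add_0)
  qed
  have "(\<Sum>j\<in>insert k I. G i j * ?x j) = b i" if "i \<in> insert k I" for i
  proof (cases "i = k")
    case True
    have "(\<Sum>j\<in>I. G k j * y j) + t * N = b k"
      using \<open>N \<noteq> 0\<close> by (simp add: t_def)
    then show ?thesis
      unfolding x True N_def .
  next
    case False
    then have "i \<in> I"
      using that by simp
    then show ?thesis
      unfolding x by (simp only: e_orth y mult_zero_right add_0_right)
  qed
  then show ?case by (intro exI[of _ ?x] ballI)
qed

section \<open>The measure on the simplex and integrability of products of multinomials\<close>

lemma sets_prob_simplex: "prob_simplex n \<in> sets (Pi\<^sub>M {..<n} (\<lambda>_. lborel))"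
proof -
  have "prob_simplex n = {r \<in> space (Pi\<^sub>M {..<n} (\<lambda>_. lborel)). (\<forall>i\<in>{..<n}. 0 \<le> r i) \<and> (\<Sum>i<n. r i) = 1}"
    by (auto simp: prob_simplex_def space_PiM)
  also have "\<dots> \<in> sets (Pi\<^sub>M {..<n} (\<lambda>_. lborel))"
    by measurable
  finally show ?thesis .
qed

lemma space_simplex_measure: "space (simplex_measure n) = prob_simplex n"
  by (auto simp: simplex_measure_def space_restrict_space space_PiM prob_simplex_def)

lemma measurable_add_last_coord:
  assumes "n \<ge> 1"
  shows "add_last_coord n \<in> Pi\<^sub>M {..<n - 1} (\<lambda>_. lborel) \<rightarrow>\<^sub>M Pi\<^sub>M {..<n} (\<lambda>_. lborel)"
  unfolding add_last_coord_def
  by (rule measurable_fun_upd[where J = "{..<n - 1}"]) (use assms in \<open>auto, measurable\<close>)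

lemma prob_simplex_le_1:
  assumes "r \<in> prob_simplex n" "i < n"
  shows "r i \<le> 1"
proof -
  have "r i \<le> (\<Sum>i<n. r i)"
    using assms by (intro member_le_sum) (auto simp: prob_simplex_def)
  then show ?thesis
    using assms by (simp add: prob_simplex_def)
qed

text \<open>In the first \<open>n - 1\<close> coordinates the simplex lies in the unit box, which
  has measure 1.\<close>

lemma finite_simplex_measure:
  assumes "n \<ge> 1"
  shows "finite_measure (simplex_measure n)"
proof
  interpret product_sigma_finite "\<lambda>_::nat. lborel :: real measure" ..
  let ?M = "Pi\<^sub>M {..<n - 1} (\<lambda>_. lborel :: real measure)"
  let ?box = "Pi\<^sub>E {..<n - 1} (\<lambda>_. {0..1::real})"
  have "add_last_coord n -` prob_simplex n \<inter> space ?M \<subseteq> ?box"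
  proof
    fix x assume x: "x \<in> add_last_coord n -` prob_simplex n \<inter> space ?M"
    then have "0 \<le> add_last_coord n x i \<and> add_last_coord n x i \<le> 1" if "i < n" for i
      using that prob_simplex_le_1[of _ n i] by (auto simp: prob_simplex_def)
    then have "0 \<le> x i \<and> x i \<le> 1" if "i < n - 1" for i
      using that unfolding add_last_coord_def
      by (metis fun_upd_other less_irrefl less_imp_diff_less diff_le_self order_less_le_trans)
    then show "x \<in> ?box"
      using x by (auto simp: space_PiM PiE_iff)
  qed
  then have "emeasure ?M (add_last_coord n -` prob_simplex n \<inter> space ?M) \<le> emeasure ?M ?box"
    by (intro emeasure_mono sets_PiM_I_finite) auto
  also have "\<dots> = 1"
    by (subst emeasure_PiM) auto
  finally have "emeasure ?M (add_last_coord n -` prob_simplex n \<inter> space ?M) \<noteq> \<infinity>"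
    by (auto simp: top_unique)
  then show "emeasure (simplex_measure n) (space (simplex_measure n)) \<noteq> \<infinity>"
    unfolding space_simplex_measure
    unfolding simplex_measure_def
    by (subst emeasure_restrict_space)
      (use sets.Int[OF sets_prob_simplex sets.top]
        in \<open>simp_all only: sets_distr space_distr order_refl not_False_eq_True infinity_ennreal_def
          emeasure_distr[OF measurable_add_last_coord[OF assms] sets_prob_simplex]\<close>)
qed

lemma measurable_multinom: "multinom n \<phi> \<in> borel_measurable (simplex_measure n)"
proof -
  have "(\<lambda>r. fact (size \<phi>) * (\<Prod>i<n. r i ^ count \<phi> i / fact (count \<phi> i)) :: real)
      \<in> borel_measurable (simplex_measure n)"
    unfolding simplex_measure_def by (rule measurable_restrict_space1) measurable
  then show ?thesis
    by (subst measurable_cong[OF multinom_simplex]) (simp_all add: space_simplex_measure)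
qed

text \<open>Each divided power lies between 0 and 1, so only the leading factorial remains. On a
  finite measure such a crude bound suffices for integrability.\<close>

lemma multinom_bounds:
  assumes "r \<in> prob_simplex n"
  shows "0 \<le> multinom n \<phi> r" and "multinom n \<phi> r \<le> fact (size \<phi>)"
proof -
  have "0 \<le> r i ^ count \<phi> i / fact (count \<phi> i) \<and> r i ^ count \<phi> i / fact (count \<phi> i) \<le> 1" if "i < n" for i
  proof -
    have "0 \<le> r i" "r i ^ count \<phi> i \<le> 1"
      using that assms prob_simplex_le_1[of r n i] by (auto simp: prob_simplex_def power_le_one)
    then show ?thesis
      by (simp add: order_trans[OF _ fact_ge_1])
  qed
  then have "0 \<le> (\<Prod>i<n. r i ^ count \<phi> i / fact (count \<phi> i))"
      "(\<Prod>i<n. r i ^ count \<phi> i / fact (count \<phi> i)) \<le> 1"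
    by (auto intro!: prod_nonneg prod_le_1)
  then show "0 \<le> multinom n \<phi> r" "multinom n \<phi> r \<le> fact (size \<phi>)"
    using assms by (simp_all add: multinom_simplex mult_le_cancel_left1)
qed

lemma integrable_multinom_mult:
  assumes "n \<ge> 1"
  shows "integrable (simplex_measure n) (\<lambda>r. multinom n \<phi> r * multinom n \<psi> r)"
proof -
  interpret finite_measure "simplex_measure n"
    using finite_simplex_measure[OF assms] .
  show ?thesis
    by (rule integrable_const_bound[where B = "fact (size \<phi>) * fact (size \<psi>)"])
      (auto intro!: AE_I2 mult_mono borel_measurable_times
        simp: space_simplex_measure measurable_multinom multinom_bounds abs_mult)
qed

section \<open>Continuous functions that vanish almost everywhere on the simplex\<close>

text \<open>Negligibility refers to the completion of \<open>lborel\<close>; an open set is Borel,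
  so it is null for both measures or for neither.\<close>

lemma emeasure_lborel_open_neq_0:
  fixes S :: "'a :: euclidean_space set"
  assumes "open S" "S \<noteq> {}"
  shows "emeasure lborel S \<noteq> 0"
  using open_not_negligible[OF assms] assms(1)
  by (auto simp: negligible_iff_null_sets null_sets_completion_iff intro!: null_setsI)

text \<open>Around a positive point where \<open>f\<close> is nonzero there is a box of positive measure on which
  \<open>f \<circ> add_last_coord n\<close> does not vanish.\<close>
lemma AE_simplex_measure_continuous_eq_0:
  fixes f :: "(nat \<Rightarrow> real) \<Rightarrow> real"
  assumes "n \<ge> 1" and cont: "continuous_on UNIV f"
    and AE: "AE r in simplex_measure n. f r = 0"
    and r: "r \<in> prob_simplex n" "\<And>i. i < n \<Longrightarrow> 0 < r i"
  shows "f r = 0"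
proof (rule ccontr)
  assume "f r \<noteq> 0"
  interpret product_sigma_finite "\<lambda>_::nat. lborel :: real measure" ..
  let ?g = "add_last_coord n"
  have sum_split: "(\<Sum>i<n. h i) = (\<Sum>i<n - 1. h i) + h (n - 1)" for h :: "nat \<Rightarrow> real"
    using assms(1) by (cases n) auto
  \<comment> \<open>The last coordinate of a point of the simplex is determined by the others, so
    overwriting it changes nothing.\<close>
  have g_r: "?g r = r"
    using r sum_split[of r] by (simp add: add_last_coord_def prob_simplex_def fun_upd_idem)
  have cont_g: "continuous_on UNIV ?g"
  proof (rule continuous_on_coordinatewise_then_product)
    show "continuous_on UNIV (\<lambda>x. ?g x i)" for i
      by (cases "i = n - 1") (auto simp: add_last_coord_def intro!: continuous_intros)
  qed
  \<comment> \<open>\<open>U\<close> is open in the product topology on all functions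
    \<open>nat \<Rightarrow> real\<close>; a basic box around \<open>r\<close> inside
    \<open>U\<close> is then cut down to the first \<open>n - 1\<close> coordinates.\<close>
  define U where "U = {x. f (?g x) \<noteq> 0} \<inter> (\<Inter>i<n. {x. 0 < ?g x i})"
  have "open U"
    unfolding U_def
    by (intro open_Int open_INT open_Collect_neq open_Collect_less ballI continuous_on_const
        continuous_on_compose2[OF cont cont_g] continuous_on_product_then_coordinatewise[OF cont_g]) auto
  moreover have "r \<in> U"
    using r \<open>f r \<noteq> 0\<close> by (simp add: U_def g_r)
  ultimately obtain X where X: "r \<in> Pi\<^sub>E UNIV X" "\<And>i. open (X i)" "Pi\<^sub>E UNIV X \<subseteq> U"
    using product_topology_open_contains_basis[of "\<lambda>_. euclidean" UNIV U r] by (auto simp: open_fun_def)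
  let ?M = "Pi\<^sub>M {..<n - 1} (\<lambda>_. lborel :: real measure)"
  let ?B = "Pi\<^sub>E {..<n - 1} X"
  have B: "?g x \<in> prob_simplex n \<and> f (?g x) \<noteq> 0" if x: "x \<in> ?B" for x
  proof -
    \<comment> \<open>A point of \<open>?B\<close> is undefined from \<open>n - 1\<close> on.
      Filling in the coordinates of \<open>r\<close> puts it into the full box without changing its
      image: coordinate \<open>n - 1\<close> is overwritten, and \<open>r\<close> is itself
      undefined from \<open>n\<close> on.\<close>
    let ?x = "\<lambda>i. if i < n - 1 then x i else r i"
    have "?g ?x = ?g x"
      using x r by (auto simp: add_last_coord_def fun_eq_iff PiE_iff extensional_def prob_simplex_def)
    moreover have "?x \<in> Pi\<^sub>E UNIV X"
      using x X(1) by (auto simp: PiE_iff)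
    ultimately have "f (?g x) \<noteq> 0" "\<And>i. i < n \<Longrightarrow> 0 < ?g x i"
      using X(3) by (auto simp: U_def subset_iff)
    moreover have "(\<Sum>i<n - 1. ?g x i) = (\<Sum>i<n - 1. x i)"
      by (intro sum.cong) (auto simp: add_last_coord_def)
    then have "(\<Sum>i<n. ?g x i) = 1"
      by (simp add: sum_split) (simp add: add_last_coord_def)
    moreover have "?g x \<in> extensional {..<n}"
      using x assms(1) by (auto simp: add_last_coord_def PiE_iff extensional_def)
    ultimately show ?thesis
      by (auto simp: prob_simplex_def PiE_iff less_imp_le)
  qed
  have "AE r in distr ?M (Pi\<^sub>M {..<n} (\<lambda>_. lborel)) ?g. r \<in> prob_simplex n \<longrightarrow> f r = 0"
    using AE unfolding simplex_measure_def
    by (subst (asm) AE_restrict_space_iff)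
      (use sets.Int[OF sets_prob_simplex sets.top] in \<open>simp_all only: sets_distr space_distr\<close>)
  then have "AE x in ?M. ?g x \<in> prob_simplex n \<longrightarrow> f (?g x) = 0"
    by (rule AE_distrD[OF measurable_add_last_coord[OF assms(1)]])
  then have "AE x in ?M. x \<notin> ?B"
    by eventually_elim (use B in blast)
  moreover have "?B \<in> sets ?M"
    using X(2) by (intro sets_PiM_I_finite) auto
  ultimately have "emeasure ?M ?B = 0"
    using AE_iff_null_sets by blast
  moreover have "emeasure ?M ?B = (\<Prod>i<n - 1. emeasure lborel (X i))"
    using X(2) by (intro emeasure_PiM) auto
  moreover have "emeasure lborel (X i) \<noteq> 0" for i
    using X(1,2) by (intro emeasure_lborel_open_neq_0) auto
  ultimately show False
    by simp
qed

section \<open>Linear independence of the multinomials\<close>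

text \<open>The lowest digit is the remainder modulo \<open>B\<close>; cancelling it and dividing by
  \<open>B\<close> leaves the shifted expansions for the induction.\<close>

lemma base_expansion_unique:
  fixes a b :: "nat \<Rightarrow> nat"
  assumes "\<And>i. i < n \<Longrightarrow> a i < B" "\<And>i. i < n \<Longrightarrow> b i < B"
    and "(\<Sum>i<n. a i * B ^ i) = (\<Sum>i<n. b i * B ^ i)" and "i < n"
  shows "a i = b i"
  using assms
proof (induction n arbitrary: a b i)
  case 0
  then show ?case by simp
next
  case (Suc n)
  have shift: "(\<Sum>i<Suc n. h i * B ^ i) = h 0 + B * (\<Sum>i<n. h (Suc i) * B ^ i)" for h
    by (simp add: sum.lessThan_Suc_shift sum_distrib_left mult_ac del: sum.lessThan_Suc)
  have eq: "a 0 + B * (\<Sum>i<n. a (Suc i) * B ^ i) = b 0 + B * (\<Sum>i<n. b (Suc i) * B ^ i)"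
    using Suc.prems(3) unfolding shift .
  have less: "a 0 < B" "b 0 < B"
    using Suc.prems(1,2) by auto
  have a0: "a 0 = b 0"
    using arg_cong[OF eq, of "\<lambda>x. x mod B"] less by simp
  show ?case
  proof (cases i)
    case 0
    then show ?thesis using a0 by simp
  next
    case (Suc j)
    have "(\<Sum>i<n. a (Suc i) * B ^ i) = (\<Sum>i<n. b (Suc i) * B ^ i)"
      using eq a0 less by simp
    then show ?thesis
      using Suc.IH[of "\<lambda>i. a (Suc i)" "\<lambda>i. b (Suc i)" j] Suc Suc.prems by simp
  qed
qed

text \<open>Kronecker substitution: along the curve $r_i \propto t^{(L+1)^i}$ distinct multinomials
  become distinct powers of $t$, up to a common factor.\<close>
lemma multinom_independent:
  assumes "n \<ge> 1"
    and zero: "\<And>r. r \<in> prob_simplex n \<Longrightarrow> (\<And>i. i < n \<Longrightarrow> 0 < r i) \<Longrightarrow>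
      (\<Sum>\<phi>\<in>multisets_of_size {..<n} L. c \<phi> * multinom n \<phi> r) = 0"
    and \<psi>: "\<psi> \<in> multisets_of_size {..<n} L"
  shows "c \<psi> = 0"
proof -
  let ?I = "multisets_of_size {..<n} L"
  \<comment> \<open>The multiplicities, at most \<open>L\<close>, are read as digits in base
    \<open>L + 1\<close>, which makes \<open>e\<close> injective on \<open>?I\<close>.\<close>
  define e where "e \<phi> = (\<Sum>i<n. count \<phi> i * Suc L ^ i)" for \<phi>
  define k :: "nat multiset \<Rightarrow> real" where "k \<phi> = fact L / (\<Prod>i<n. fact (count \<phi> i))" for \<phi>
  \<comment> \<open>Along the curve the linear combination is \<open>poly P t\<close> divided by a
    positive normalising factor, so every positive real is a root of \<open>P\<close>.\<close>
  define P where "P = (\<Sum>\<phi>\<in>?I. monom (c \<phi> * k \<phi>) (e \<phi>))"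
  have inj: "\<phi> = \<psi>" if "\<phi> \<in> ?I" "\<psi> \<in> ?I" "e \<phi> = e \<psi>" for \<phi> \<psi>
  proof (rule multiset_eqI)
    fix i
    have "count \<phi> i < Suc L" "count \<psi> i < Suc L" for i
      using that count_le_size[of \<phi> i] count_le_size[of \<psi> i] by (auto simp: multisets_of_size_def)
    then show "count \<phi> i = count \<psi> i"
    proof (cases "i < n")
      case True
      then show ?thesis
        using base_expansion_unique[of n "count \<phi>" "Suc L" "count \<psi>" i] that
          \<open>\<And>i. count \<phi> i < Suc L\<close> \<open>\<And>i. count \<psi> i < Suc L\<close> by (simp add: e_def)
    next
      case False
      then have "i \<notin># \<phi>" "i \<notin># \<psi>"
        using that by (auto simp: multisets_of_size_def)
      then show ?thesis
        by (simp add: not_in_iff)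
    qed
  qed
  have "poly P t = 0" if "t > 0" for t
  proof -
    define s where "s = (\<Sum>i<n. t ^ (Suc L ^ i))"
    have "s > 0"
      unfolding s_def using that assms(1) by (intro sum_pos) (auto simp: lessThan_empty_iff)
    define r where "r = (\<lambda>i\<in>{..<n}. t ^ (Suc L ^ i) / s)"
    have r: "r \<in> prob_simplex n" "\<And>i. i < n \<Longrightarrow> 0 < r i"
      using that \<open>s > 0\<close>
      by (auto simp: r_def prob_simplex_def s_def less_imp_le simp flip: sum_divide_distrib)
    have "c \<phi> * multinom n \<phi> r = c \<phi> * k \<phi> * t ^ e \<phi> / s ^ L" if "\<phi> \<in> ?I" for \<phi>
    proof -
      \<comment> \<open>All terms have the same degree, so normalisation contributes the same power
        \<open>s ^ L\<close> to each of them.\<close>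
      have \<phi>: "size \<phi> = L" "(\<Sum>i<n. count \<phi> i) = L"
        using that by (auto simp: multisets_of_size_def size_multiset_overloaded_eq not_in_iff
            intro!: sum.mono_neutral_right)
      have "(\<Prod>i<n. r i ^ count \<phi> i) = (\<Prod>i<n. t ^ (count \<phi> i * Suc L ^ i) / s ^ count \<phi> i)"
        by (intro prod.cong) (auto simp: r_def power_divide mult.commute simp flip: power_mult)
      also have "\<dots> = t ^ e \<phi> / s ^ L"
        by (simp add: prod_dividef power_sum e_def flip: \<phi>(2))
      finally show ?thesis
        using r \<phi>(1) by (simp add: multinom_simplex prod_dividef k_def mult_ac)
    qed
    then have "(\<Sum>\<phi>\<in>?I. c \<phi> * k \<phi> * t ^ e \<phi>) / s ^ L = 0"
      using zero[OF r] by (simp add: sum_divide_distrib)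
    then show ?thesis
      using \<open>s > 0\<close> by (simp add: P_def poly_sum poly_monom)
  qed
  then have "P = 0"
    using infinite_Ioi[of "0::real"] poly_roots_finite[of P]
    by (metis (mono_tags, lifting) finite_subset greaterThan_iff mem_Collect_eq subsetI)
  moreover have "coeff P (e \<psi>) = (\<Sum>\<phi>\<in>?I. if \<phi> = \<psi> then c \<phi> * k \<phi> else 0)"
    unfolding P_def coeff_sum coeff_monom using inj \<psi> by (intro sum.cong) auto
  ultimately have "c \<psi> * k \<psi> = 0"
    using \<psi> by (simp add: finite_multisets_of_size)
  then show ?thesis
    by (simp add: k_def)
qed

section \<open>The Gram matrix and the dual multinomials\<close>

lemma simplex_inner_multinom_sum:
  assumes "n \<ge> 1" and d: "\<And>r. r \<in> prob_simplex n \<Longrightarrow> d r = (\<Sum>\<psi>\<in>I. c \<psi> * multinom n \<psi> r)"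
  shows "simplex_inner n (multinom n \<phi>) d =
    (\<Sum>\<psi>\<in>I. c \<psi> * simplex_inner n (multinom n \<phi>) (multinom n \<psi>))"
proof -
  have "simplex_inner n (multinom n \<phi>) d =
      (LINT r|simplex_measure n. (\<Sum>\<psi>\<in>I. c \<psi> * (multinom n \<phi> r * multinom n \<psi> r)))"
    unfolding simplex_inner_def
    by (intro Bochner_Integration.integral_cong)
      (simp_all add: d space_simplex_measure sum_distrib_left mult_ac)
  also have "\<dots> = (\<Sum>\<psi>\<in>I. c \<psi> * simplex_inner n (multinom n \<phi>) (multinom n \<psi>))"
    by (simp add: simplex_inner_def integrable_multinom_mult[OF assms(1)])
  finally show ?thesis .
qed

text \<open>The quadratic form of the Gram matrix is the integral of the square of the linear
  combination with coefficients \<open>c\<close>.\<close>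

lemma multinom_gram_definite:
  assumes "n \<ge> 1"
    and zero: "(\<Sum>\<phi>\<in>multisets_of_size {..<n} L. \<Sum>\<psi>\<in>multisets_of_size {..<n} L.
      c \<phi> * c \<psi> * simplex_inner n (multinom n \<phi>) (multinom n \<psi>)) = 0"
  shows "\<forall>\<phi>\<in>multisets_of_size {..<n} L. c \<phi> = 0"
proof -
  let ?I = "multisets_of_size {..<n} L"
  define f where "f r = (\<Sum>\<phi>\<in>?I. c \<phi> * multinom n \<phi> r)" for r
  \<comment> \<open>\<open>f\<close> is built from functions restricted to the simplex. The
    polynomial \<open>g\<close> agrees with it there and is continuous on the whole space, as the
    almost-everywhere argument demands.\<close>
  define g :: "(nat \<Rightarrow> real) \<Rightarrow> real" where
    "g r = (\<Sum>\<phi>\<in>?I. c \<phi> * (fact (size \<phi>) * (\<Prod>i<n. r i ^ count \<phi> i / fact (count \<phi> i))))" for r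
  have f_g: "f r = g r" if "r \<in> prob_simplex n" for r
    using that by (simp add: f_def g_def multinom_simplex)
  have square: "(f r)\<^sup>2 = (\<Sum>\<phi>\<in>?I. \<Sum>\<psi>\<in>?I. c \<phi> * c \<psi> * (multinom n \<phi> r * multinom n \<psi> r))" for r
    by (simp add: f_def power2_eq_square sum_product mult_ac)
  have "integrable (simplex_measure n) (\<lambda>r. (f r)\<^sup>2)"
    unfolding square
    by (intro Bochner_Integration.integrable_sum integrable_mult_right integrable_multinom_mult assms(1))
  moreover have "(LINT r|simplex_measure n. (f r)\<^sup>2) = 0"
    using zero unfolding square by (simp add: simplex_inner_def integrable_multinom_mult[OF assms(1)])
  ultimately have "AE r in simplex_measure n. (f r)\<^sup>2 = 0"
    by (simp add: integral_nonneg_eq_0_iff_AE)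
  then have "AE r in simplex_measure n. g r = 0"
    using AE_space by eventually_elim (simp add: space_simplex_measure f_g)
  moreover have "continuous_on UNIV g"
    unfolding g_def by (intro continuous_intros) auto
  ultimately have "f r = 0" if "r \<in> prob_simplex n" "\<And>i. i < n \<Longrightarrow> 0 < r i" for r
    using AE_simplex_measure_continuous_eq_0[OF assms(1)] that f_g by metis
  then show ?thesis
    using multinom_independent[OF assms(1), where L = L and c = c] unfolding f_def by blast
qed

text \<open>Existence solves the Gram system for the coefficients; uniqueness applies definiteness
  to the difference of two coefficient vectors. With \<open>b\<close> a Kronecker delta this
  justifies the definite description in \<open>dual_multinom\<close>.\<close>

lemma dual_multinom_ex1:
  assumes "n \<ge> 1"
  shows "\<exists>!d. d \<in> multinom_space n L \<and>
    (\<forall>\<phi>\<in>multisets_of_size {..<n} L. simplex_inner n (multinom n \<phi>) d = b \<phi>)"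
proof -
  let ?I = "multisets_of_size {..<n} L"
  let ?G = "\<lambda>\<phi> \<psi>. simplex_inner n (multinom n \<phi>) (multinom n \<psi>)"
  define lin where "lin c = (\<lambda>r\<in>prob_simplex n. \<Sum>\<psi>\<in>?I. c \<psi> * multinom n \<psi> r)"
    for c :: "nat multiset \<Rightarrow> real"
  have space: "d \<in> multinom_space n L \<longleftrightarrow> (\<exists>c. d = lin c)" for d
    by (auto simp: multinom_space_def lin_def)
  have inner: "simplex_inner n (multinom n \<phi>) (lin c) = (\<Sum>\<psi>\<in>?I. c \<psi> * ?G \<phi> \<psi>)" for c \<phi>
    by (rule simplex_inner_multinom_sum[OF assms]) (simp add: lin_def)
  have "finite ?I"
    by (simp add: finite_multisets_of_size)
  then have "\<exists>x. \<forall>\<phi>\<in>?I. (\<Sum>\<psi>\<in>?I. ?G \<phi> \<psi> * x \<psi>) = b \<phi>"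
    using multinom_gram_definite[OF assms] by (rule definite_linear_system_solvable)
  then obtain x where "\<forall>\<phi>\<in>?I. (\<Sum>\<psi>\<in>?I. ?G \<phi> \<psi> * x \<psi>) = b \<phi>"
    by blast
  then have x: "\<forall>\<phi>\<in>?I. simplex_inner n (multinom n \<phi>) (lin x) = b \<phi>"
    by (simp add: inner mult.commute)
  show ?thesis
  proof (rule ex1I[of _ "lin x"])
    show "lin x \<in> multinom_space n L \<and> (\<forall>\<phi>\<in>?I. simplex_inner n (multinom n \<phi>) (lin x) = b \<phi>)"
      using x space by blast
  next
    fix d
    assume d: "d \<in> multinom_space n L \<and> (\<forall>\<phi>\<in>?I. simplex_inner n (multinom n \<phi>) d = b \<phi>)"
    then obtain y where y: "d = lin y"
      using space by blast
    let ?c = "\<lambda>\<phi>. y \<phi> - x \<phi>"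
    have "(\<Sum>\<psi>\<in>?I. ?c \<psi> * ?G \<phi> \<psi>) = 0" if "\<phi> \<in> ?I" for \<phi>
      using d x that by (simp add: y inner left_diff_distrib sum_subtractf)
    then have "(\<Sum>\<phi>\<in>?I. ?c \<phi> * (\<Sum>\<psi>\<in>?I. ?c \<psi> * ?G \<phi> \<psi>)) = 0"
      by simp
    then have "(\<Sum>\<phi>\<in>?I. \<Sum>\<psi>\<in>?I. ?c \<phi> * ?c \<psi> * ?G \<phi> \<psi>) = 0"
      by (simp only: sum_distrib_left mult.assoc)
    then have "\<forall>\<phi>\<in>?I. ?c \<phi> = 0"
      by (rule multinom_gram_definite[OF assms])
    then show "d = lin x"
      by (auto simp: y lin_def fun_eq_iff intro!: sum.cong)
  qed
qed

lemma simplex_inner_dual_multinom: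
  assumes "n \<ge> 1" "\<phi> \<in> multisets_of_size {..<n} (size \<psi>)"
  shows "simplex_inner n (multinom n \<phi>) (dual_multinom n \<psi>) = (if \<phi> = \<psi> then 1 else 0)"
  using theI'[OF dual_multinom_ex1[OF assms(1), of "size \<psi>" "\<lambda>\<phi>. if \<phi> = \<psi> then 1 else 0"]] assms(2)
  unfolding dual_multinom_def by blast

lemma dual_multinom_in_space:
  assumes "n \<ge> 1"
  shows "dual_multinom n \<psi> \<in> multinom_space n (size \<psi>)"
  using theI'[OF dual_multinom_ex1[OF assms(1), of "size \<psi>" "\<lambda>\<phi>. if \<phi> = \<psi> then 1 else 0"]]
  unfolding dual_multinom_def by blast

text \<open>A dual multinomial is a finite combination of multinomials, so products of two
  multinomials suffice. This permits exchanging the integral with the finite expansion of a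
  multinomial in degree \<open>L\<close>.\<close>

lemma integrable_multinom_dual_multinom:
  assumes "n \<ge> 1"
  shows "integrable (simplex_measure n) (\<lambda>r. multinom n \<phi> r * dual_multinom n \<psi> r)"
proof -
  let ?I = "multisets_of_size {..<n} (size \<psi>)"
  obtain c where c: "dual_multinom n \<psi> = (\<lambda>r\<in>prob_simplex n. \<Sum>\<omega>\<in>?I. c \<omega> * multinom n \<omega> r)"
    using dual_multinom_in_space[OF assms, of \<psi>] by (auto simp: multinom_space_def)
  have "integrable (simplex_measure n) (\<lambda>r. \<Sum>\<omega>\<in>?I. c \<omega> * (multinom n \<phi> r * multinom n \<omega> r))"
    by (intro Bochner_Integration.integrable_sum integrable_mult_right integrable_multinom_mult assms)
  then show ?thesis
    by (subst Bochner_Integration.integrable_cong[OF refl])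
      (auto simp: c space_simplex_measure sum_distrib_left mult_ac)
qed

section \<open>Comparison of the signed and the ordinary hypergeometric distribution\<close>

theorem theorem13:
  fixes n K L :: nat and \<upsilon> :: "nat multiset"
  assumes "n \<ge> 1"
    and "set_mset \<upsilon> \<subseteq> {..<n}"
    and "L = size \<upsilon>"
    and "K \<le> L"
  shows "shg n K \<upsilon> = hg n K \<upsilon>"
proof -
  let ?I = "multisets_of_size {..<n} L"
  have \<upsilon>: "\<upsilon> \<in> ?I" "finite ?I"
    using assms by (simp_all add: multisets_of_size_def finite_multisets_of_size[unfolded multisets_of_size_def])
  have "(LINT r|simplex_measure n. multinom n \<phi> r * dual_multinom n \<upsilon> r) = hg n K \<upsilon> \<phi>"
    if \<phi>: "\<phi> \<in> multisets_of_size {..<n} K" for \<phi>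
  proof -
    have "(LINT r|simplex_measure n. multinom n \<phi> r * dual_multinom n \<upsilon> r) =
        (LINT r|simplex_measure n. (\<Sum>\<omega>\<in>?I. hg n K \<omega> \<phi> * (multinom n \<omega> r * dual_multinom n \<upsilon> r)))"
      by (intro Bochner_Integration.integral_cong refl)
        (simp add: space_simplex_measure multinom_eq_sum_hg[OF _ \<phi> assms(4)] sum_distrib_right mult.assoc)
    also have "\<dots> = (\<Sum>\<omega>\<in>?I. hg n K \<omega> \<phi> * simplex_inner n (multinom n \<omega>) (dual_multinom n \<upsilon>))"
      by (simp add: simplex_inner_def integrable_multinom_dual_multinom[OF assms(1)])
    \<comment> \<open>The coefficient at \<open>\<omega>\<close> is the hypergeometric probability
      of \<open>\<phi>\<close> for the urn \<open>\<omega>\<close>, so biorthogonality selects the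
      urn \<open>\<upsilon>\<close>.\<close>
    also have "\<dots> = (\<Sum>\<omega>\<in>?I. if \<omega> = \<upsilon> then hg n K \<omega> \<phi> else 0)"
      using assms(3) by (intro sum.cong) (simp_all add: simplex_inner_dual_multinom[OF assms(1)])
    also have "\<dots> = hg n K \<upsilon> \<phi>"
      using \<upsilon> by simp
    finally show ?thesis .
  qed
  \<comment> \<open>Both sides are restricted to multisets of size \<open>K\<close> and
    \<open>undefined\<close> elsewhere, so agreement on these is equality of functions.\<close>
  then show ?thesis
    by (auto simp: shg_def hg_def fun_eq_iff)
qed

end
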